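(* Let $H$ be a real Hilbert space, let $A,B:H\rightrightarrows H$ be maximal monotone operators, and let $\{z_k\}_{k\ge 0},\{w_k\}_{k\ge 0}$, $\{a_k\}_{k\ge1}$, $\{y_k\}_{k\ge1}$, $\{b_k\}_{k\ge1}$, $\{x_k\}_{k\ge1}$ be sequences generated by Algorithm I (described in the context). If $S_e(A,B)\neq\emptyset$, then the sequences $\{(x_k,b_k)\}$, $\{(y_k,-a_k)\}$ and $\{(z_k,w_k)\}$ converge weakly (in $H\times H$) to a point in $S_e(A,B)$; that is, there is a point of $S_e(A,B)$ to which all three sequences converge weakly.
   Context: $H$ is a real Hilbert space with inner product $\langle\cdot,\cdot\rangle$ and induced norm $\|\cdot\|$; $H\times H$ carries the canonical product inner product. $A,B:H\rightrightarrows H$ are maximal monotone (set-valued) operators. Extended solution set: $S_e(A,B)=\{(z,w)\in H\times H : w\in B(z),\ -w\in A(z)\}$. $\varepsilon$-enlargement: for a maximal monotone $T:H\rightrightarrows H$, $\varepsilon\ge 0$, $z\in H$, $$T^{[\varepsilon]}(z)=\{v\in H : \langle z-z',v-v'\rangle\ge-\varepsilon\ \ \forall z'\in H,\ v'\in T(z')\}.$$ Algorithm I (inexact Douglas-Rachford method with relative error tolerance): fix $z_0,w_0\in H$, $\lambda>0$, and $0<\sigma<\nu<1$. For $k=1,2,3,\dots$: (1) Find $a_k,y_k,b_k,x_k\in H$ and $\varepsilon_k,\mu_k\ge0$ (any choice is allowed) such that $a_k\in A^{[\varepsilon_k]}(y_k)$, $b_k\in B^{[\mu_k]}(x_k)$,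 and $\delta_k\le\frac{\sigma^2}{4}\rho_k$, where $$\delta_k=\|\lambda a_k+y_k-(z_{k-1}-\lambda w_{k-1})\|^2+\|\lambda b_k+x_k-(y_k+\lambda w_{k-1})\|^2+2\lambda(\varepsilon_k+\mu_k),$$ $$\rho_k=\|\lambda(a_k+b_k)\|^2+\|x_k-y_k\|^2.$$ (2) Set $t_k=0$ if $a_k+b_k=x_k-y_k=0$, and otherwise $$t_k=\nu\max\left\{0,\ \sqrt{\frac{4\delta_k}{\sigma^2\rho_k}}-\frac{\|\lambda(a_k+w_{k-1})\|^2}{\rho_k}\right\};$$ then set $z_k=z_{k-1}-(1-t_k)\lambda(a_k+b_k)$ and $w_k=w_{k-1}-(1-t_k)\lambda^{-1}(x_k-y_k)$. *)

theory Defs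
  imports "HOL-Analysis.Analysis"
begin

text \<open>A set-valued operator on \<open>H\<close> is a function \<open>'a \<Rightarrow> 'a set\<close>; a real Hilbert space is a type of
  sort \<open>{real_inner, complete_space}\<close>.\<close>

definition monotone_operator :: "('a::real_inner \<Rightarrow> 'a set) \<Rightarrow> bool" where
  "monotone_operator T \<longleftrightarrow>
     (\<forall>z z' v v'. v \<in> T z \<longrightarrow> v' \<in> T z' \<longrightarrow> inner (z - z') (v - v') \<ge> 0)"

definition maximal_monotone :: "('a::real_inner \<Rightarrow> 'a set) \<Rightarrow> bool" where
  "maximal_monotone T \<longleftrightarrow>
     monotone_operator T \<and>
     (\<forall>S. monotone_operator S \<longrightarrow> (\<forall>z. T z \<subseteq> S z) \<longrightarrow> S = T)"

definition extended_solution_set ::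
  "('a::real_inner \<Rightarrow> 'a set) \<Rightarrow> ('a \<Rightarrow> 'a set) \<Rightarrow> ('a \<times> 'a) set" where
  "extended_solution_set A B = {(z, w). w \<in> B z \<and> - w \<in> A z}"

definition enlargement :: "('a::real_inner \<Rightarrow> 'a set) \<Rightarrow> real \<Rightarrow> 'a \<Rightarrow> 'a set" where
  "enlargement T \<epsilon> z = {v. \<forall>z'. \<forall>v' \<in> T z'. inner (z - z') (v - v') \<ge> - \<epsilon>}"

text \<open>Weak convergence in the Hilbert space sense: convergence of all scalar products with a fixed
  vector. On \<open>'a \<times> 'a\<close> the library's inner product is the canonical product one.\<close>

definition weakly_converges :: "(nat \<Rightarrow> 'a::real_inner) \<Rightarrow> 'a \<Rightarrow> bool" where
  "weakly_converges X l \<longleftrightarrow> (\<forall>u. (\<lambda>k. inner (X k) u) \<longlonglongrightarrow> inner l u)"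

text \<open>In \<open>DR_delta\<close> and \<open>DR_t\<close>, \<open>z\<close> and \<open>w\<close> stand for the previous iterates
  \<open>z\<^sub>k\<^sub>-\<^sub>1\<close> and \<open>w\<^sub>k\<^sub>-\<^sub>1\<close>; the other vectors are those chosen at step \<open>k\<close>.\<close>

definition DR_delta ::
  "real \<Rightarrow> 'a::real_inner \<Rightarrow> 'a \<Rightarrow> 'a \<Rightarrow> 'a \<Rightarrow> 'a \<Rightarrow> 'a \<Rightarrow> real \<Rightarrow> real \<Rightarrow> real" where
  "DR_delta lam z w a y b x \<epsilon> \<mu> =
     (norm (lam *\<^sub>R a + y - (z - lam *\<^sub>R w)))\<^sup>2
     + (norm (lam *\<^sub>R b + x - (y + lam *\<^sub>R w)))\<^sup>2
     + 2 * lam * (\<epsilon> + \<mu>)"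

definition DR_rho :: "real \<Rightarrow> 'a::real_inner \<Rightarrow> 'a \<Rightarrow> 'a \<Rightarrow> 'a \<Rightarrow> real" where
  "DR_rho lam a y b x = (norm (lam *\<^sub>R (a + b)))\<^sup>2 + (norm (x - y))\<^sup>2"

definition DR_t ::
  "real \<Rightarrow> real \<Rightarrow> real \<Rightarrow> 'a::real_inner \<Rightarrow> 'a \<Rightarrow> 'a \<Rightarrow> 'a \<Rightarrow> 'a \<Rightarrow> 'a \<Rightarrow> real \<Rightarrow> real \<Rightarrow> real" where
  "DR_t lam \<sigma> \<nu> z w a y b x \<epsilon> \<mu> =
     (if a + b = 0 \<and> x - y = 0 then 0
      else \<nu> * max 0
        (sqrt (4 * DR_delta lam z w a y b x \<epsilon> \<mu> / (\<sigma>\<^sup>2 * DR_rho lam a y b x))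
         - (norm (lam *\<^sub>R (a + w)))\<^sup>2 / DR_rho lam a y b x))"

text \<open>The given sequences form a run of the algorithm with starting point \<open>(z 0, w 0)\<close>. The values
  of \<open>a, y, b, x, \<epsilon>, \<mu>\<close> at index \<open>0\<close> are irrelevant.\<close>

definition inexact_DR ::
  "('a::real_inner \<Rightarrow> 'a set) \<Rightarrow> ('a \<Rightarrow> 'a set) \<Rightarrow> real \<Rightarrow> real \<Rightarrow> real \<Rightarrow>
   (nat \<Rightarrow> 'a) \<Rightarrow> (nat \<Rightarrow> 'a) \<Rightarrow> (nat \<Rightarrow> 'a) \<Rightarrow> (nat \<Rightarrow> 'a) \<Rightarrow> (nat \<Rightarrow> 'a) \<Rightarrow> (nat \<Rightarrow> 'a) \<Rightarrow>
   (nat \<Rightarrow> real) \<Rightarrow> (nat \<Rightarrow> real) \<Rightarrow> bool" where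
  "inexact_DR A B lam \<sigma> \<nu> z w a y b x \<epsilon> \<mu> \<longleftrightarrow>
     (\<forall>k\<ge>1.
        \<epsilon> k \<ge> 0 \<and> \<mu> k \<ge> 0 \<and>
        a k \<in> enlargement A (\<epsilon> k) (y k) \<and>
        b k \<in> enlargement B (\<mu> k) (x k) \<and>
        DR_delta lam (z (k - 1)) (w (k - 1)) (a k) (y k) (b k) (x k) (\<epsilon> k) (\<mu> k)
          \<le> \<sigma>\<^sup>2 / 4 * DR_rho lam (a k) (y k) (b k) (x k) \<and>
        (let t = DR_t lam \<sigma> \<nu> (z (k - 1)) (w (k - 1)) (a k) (y k) (b k) (x k) (\<epsilon> k) (\<mu> k)
         in z k = z (k - 1) - ((1 - t) * lam) *\<^sub>R (a k + b k) \<and>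
            w k = w (k - 1) - ((1 - t) * inverse lam) *\<^sub>R (x k - y k)))"

end

theory Submission
  imports Defs
begin

text \<open>
  Replacing \<open>w\<close>, \<open>a\<close>, \<open>b\<close> by their multiples with \<open>lam\<close>, and the operators and the error bounds
  accordingly, turns a run into one with \<open>lam = 1\<close>. In that case the method is a projection
  method: the sum of the two enlargement inequalities at a solution \<open>(s, v)\<close> is affine in \<open>(s, v)\<close>
  because the terms \<open>\<langle>s, v\<rangle>\<close> cancel, so it defines a half-space that contains the solution set, up
  to the errors \<open>\<epsilon>, \<mu>\<close>, with normal direction \<open>(a + b, x - y)\<close>, and the update of \<open>(z, w)\<close> is a move
  in that direction. The choice of \<open>t\<close> makes every step decrease the squared distance to every
  solution by a positive multiple of \<open>\<delta>\<close> plus a positive multiple of \<open>\<parallel>a + w\<parallel>\<^sup>2\<close>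
  (\<open>DR_step_fejer\<close>). Hence the residuals, the \<open>\<epsilon>\<close>, the \<open>\<mu>\<close> and \<open>a\<^sub>k + w\<^sub>k\<^sub>-\<^sub>1\<close> tend to \<open>0\<close>.

  This says nothing about \<open>d\<^sub>k = x\<^sub>k - y\<^sub>k\<close> directly. Up to vanishing errors, \<open>x\<^sub>k + b\<^sub>k\<close> equals
  \<open>z\<^sub>k\<^sub>-\<^sub>1 + w\<^sub>k\<^sub>-\<^sub>1\<close>, whose increments vanish, and \<open>B\<close> is monotone along \<open>(x\<^sub>k, b\<^sub>k)\<close> up to the
  enlargement errors (\<open>enlargement_almost_monotone\<close>). Together these force \<open>x\<^sub>k\<^sub>+\<^sub>1 - x\<^sub>k\<close> to
  tend to \<open>0\<close>, whence \<open>d\<^sub>k\<^sub>+\<^sub>1\<close> and \<open>t\<^sub>k d\<^sub>k\<close> differ by a null sequence. As \<open>t\<^sub>k \<le> \<nu> < 1\<close>, also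
  \<open>d\<^sub>k\<close> tends to \<open>0\<close> (\<open>xy_gap_vanishes\<close>). So \<open>(x\<^sub>k, b\<^sub>k)\<close>, \<open>(y\<^sub>k, -a\<^sub>k)\<close> and \<open>(z\<^sub>k\<^sub>-\<^sub>1, w\<^sub>k\<^sub>-\<^sub>1)\<close> approach
  each other in norm, and it remains to treat \<open>(z\<^sub>k, w\<^sub>k)\<close>.

  By maximality the extended solution set is an intersection of half-spaces, one for each pair of
  graph points of \<open>A\<close> and \<open>B\<close> (\<open>extended_solution_set_halfspaces\<close>), and \<open>(z\<^sub>k, w\<^sub>k)\<close> satisfies each
  of these inequalities up to an error that tends to \<open>0\<close>. A Fejer monotone sequence with this
  property converges weakly to a point of the set (\<open>fejer_weak_convergence\<close>). Instead of weak
  compactness, the argument for this uses asymptotic centres, whose existence is a direct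
  consequence of completeness and the parallelogram law.
\<close>

section \<open>Weak convergence through asymptotic centres\<close>

text \<open>The number \<open>r\<close> is the infimum over all \<open>u\<close> of the limit superior of
  \<open>\<parallel>X i - u\<parallel>\<^sup>2\<close> along \<open>F\<close>, and it is attained at \<open>c\<close>. Filters are used so that subsequences
  are covered without reindexing.\<close>
definition asymptotic_center ::
  "'i filter \<Rightarrow> ('i \<Rightarrow> 'a::real_inner) \<Rightarrow> 'a \<Rightarrow> real \<Rightarrow> bool" where
  "asymptotic_center F X c r \<longleftrightarrow>
     (\<forall>e>0. \<forall>\<^sub>F i in F. (norm (X i - c))\<^sup>2 \<le> r + e) \<and>
     (\<forall>u q. (\<forall>\<^sub>F i in F. (norm (X i - u))\<^sup>2 \<le> q) \<longrightarrow> r \<le> q)"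

lemma norm_diff_midpoint:
  fixes p u v :: "'a::real_inner"
  shows "(norm (p - (1/2) *\<^sub>R (u + v)))\<^sup>2
    = (norm (p - u))\<^sup>2 / 2 + (norm (p - v))\<^sup>2 / 2 - (norm (u - v))\<^sup>2 / 4"
  unfolding power2_norm_eq_inner
  by (simp add: inner_diff inner_add inner_commute field_simps)

text \<open>If two points both come within \<open>e\<close> of the optimal value \<open>r\<close>, their midpoint would beat it
  unless they are close. This gives both the existence and the uniqueness of the centre.\<close>
lemma near_centers_close:
  fixes X :: "'i \<Rightarrow> 'a::real_inner"
  assumes lower: "\<And>u q. \<forall>\<^sub>F i in F. (norm (X i - u))\<^sup>2 \<le> q \<Longrightarrow> r \<le> q"
    and u: "\<forall>\<^sub>F i in F. (norm (X i - u))\<^sup>2 \<le> r + e"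
    and v: "\<forall>\<^sub>F i in F. (norm (X i - v))\<^sup>2 \<le> r + e"
  shows "(norm (u - v))\<^sup>2 \<le> 4 * e"
proof -
  have "\<forall>\<^sub>F i in F. (norm (X i - (1/2) *\<^sub>R (u + v)))\<^sup>2 \<le> r + e - (norm (u - v))\<^sup>2 / 4"
    using u v by eventually_elim (simp add: norm_diff_midpoint)
  then have "r \<le> r + e - (norm (u - v))\<^sup>2 / 4"
    by (rule lower)
  then show ?thesis by simp
qed

lemma asymptotic_center_exists:
  fixes X :: "'i \<Rightarrow> 'a::{real_inner, complete_space}"
  assumes F: "F \<noteq> bot" and bdd: "\<forall>\<^sub>F i in F. norm (X i) \<le> M"
  obtains c r where "asymptotic_center F X c r"
proof -
  define Q where "Q = {q. \<exists>u. \<forall>\<^sub>F i in F. (norm (X i - u))\<^sup>2 \<le> q}"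
  define r where "r = Inf Q"
  have "\<forall>\<^sub>F i in F. (norm (X i - 0))\<^sup>2 \<le> M\<^sup>2"
    using bdd by eventually_elim (simp add: power_mono)
  then have Q_ne: "Q \<noteq> {}" unfolding Q_def by blast
  have Q_nonneg: "0 \<le> q" if "q \<in> Q" for q
  proof -
    from that obtain u where "\<forall>\<^sub>F i in F. (norm (X i - u))\<^sup>2 \<le> q"
      unfolding Q_def by blast
    from eventually_happens'[OF F this] show ?thesis
      by (meson order_trans zero_le_power2)
  qed
  then have Q_bdd: "bdd_below Q" by (rule bdd_belowI)
  have lower: "r \<le> q" if "\<forall>\<^sub>F i in F. (norm (X i - u))\<^sup>2 \<le> q" for u q
    unfolding r_def using that Q_bdd by (intro cInf_lower) (auto simp: Q_def)
  have ex: "\<exists>u. \<forall>\<^sub>F i in F. (norm (X i - u))\<^sup>2 \<le> r + e" if e: "e > 0" for e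
  proof -
    have "Inf Q < r + e" using e by (simp add: r_def)
    then obtain q where "q \<in> Q" "q < r + e"
      using Q_ne Q_bdd by (auto simp: cInf_less_iff)
    then obtain u where "\<forall>\<^sub>F i in F. (norm (X i - u))\<^sup>2 \<le> q" unfolding Q_def by blast
    then have "\<forall>\<^sub>F i in F. (norm (X i - u))\<^sup>2 \<le> r + e"
      using \<open>q < r + e\<close> by (auto elim!: eventually_mono)
    then show ?thesis by blast
  qed
  have "\<forall>n. \<exists>u. \<forall>\<^sub>F i in F. (norm (X i - u))\<^sup>2 \<le> r + inverse (real (Suc n))"
    using ex by simp
  then obtain U where U: "\<And>n. \<forall>\<^sub>F i in F. (norm (X i - U n))\<^sup>2 \<le> r + inverse (real (Suc n))"
    by metis
  have close: "(norm (U m - U n))\<^sup>2 \<le> 4 * inverse (real (Suc N))" if "N \<le> m" "N \<le> n" for N m n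
  proof (rule near_centers_close[where F = F and X = X and r = r])
    have inv: "inverse (real (Suc k)) \<le> inverse (real (Suc N))" if "N \<le> k" for k
      using that by (simp add: le_imp_inverse_le)
    show "\<forall>\<^sub>F i in F. (norm (X i - U m))\<^sup>2 \<le> r + inverse (real (Suc N))"
      using U[of m] inv[OF \<open>N \<le> m\<close>] by (elim eventually_mono) linarith
    show "\<forall>\<^sub>F i in F. (norm (X i - U n))\<^sup>2 \<le> r + inverse (real (Suc N))"
      using U[of n] inv[OF \<open>N \<le> n\<close>] by (elim eventually_mono) linarith
  qed (rule lower)
  have "Cauchy U"
  proof (rule CauchyI)
    fix e :: real assume "0 < e"
    then obtain N where N: "inverse (real (Suc N)) < e\<^sup>2 / 4"
      using reals_Archimedean[of "e\<^sup>2 / 4"] by auto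
    have "norm (U m - U n) < e" if "N \<le> m" "N \<le> n" for m n
      using close[OF that] N \<open>0 < e\<close> by (intro power2_less_imp_less[of _ e]) auto
    then show "\<exists>N. \<forall>m\<ge>N. \<forall>n\<ge>N. norm (U m - U n) < e" by blast
  qed
  then obtain c where c: "U \<longlonglongrightarrow> c"
    using Cauchy_convergent convergent_def by blast
  have r0: "0 \<le> r" unfolding r_def using Q_ne Q_nonneg by (rule cInf_greatest)
  have "\<forall>\<^sub>F i in F. (norm (X i - c))\<^sup>2 \<le> r + e" if e: "e > 0" for e
  proof -
    have "(\<lambda>n. (sqrt (r + inverse (real (Suc n))) + norm (U n - c))\<^sup>2)
        \<longlonglongrightarrow> (sqrt (r + 0) + norm (c - c))\<^sup>2"
      by (intro tendsto_intros LIMSEQ_inverse_real_of_nat c)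
    then have "(\<lambda>n. (sqrt (r + inverse (real (Suc n))) + norm (U n - c))\<^sup>2) \<longlonglongrightarrow> r"
      using r0 by simp
    then have "\<forall>\<^sub>F n in sequentially.
        (sqrt (r + inverse (real (Suc n))) + norm (U n - c))\<^sup>2 < r + e"
      using e by (intro order_tendstoD(2)) auto
    then obtain n where n: "(sqrt (r + inverse (real (Suc n))) + norm (U n - c))\<^sup>2 < r + e"
      using eventually_happens'[OF sequentially_bot] by blast
    show ?thesis
      using U[of n]
    proof eventually_elim
      case (elim i)
      have "norm (X i - c) \<le> norm (X i - U n) + norm (U n - c)"
        using norm_triangle_ineq[of "X i - U n" "U n - c"] by simp
      also have "\<dots> \<le> sqrt (r + inverse (real (Suc n))) + norm (U n - c)"
        using elim by (simp add: real_le_rsqrt)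
      finally have "(norm (X i - c))\<^sup>2 \<le> (sqrt (r + inverse (real (Suc n))) + norm (U n - c))\<^sup>2"
        by (intro power_mono) auto
      then show ?case using n by simp
    qed
  qed
  then have "asymptotic_center F X c r"
    unfolding asymptotic_center_def using lower by blast
  then show ?thesis by (rule that)
qed

lemma asymptotic_center_unique:
  assumes c: "asymptotic_center F X c r"
    and v: "\<And>e. e > 0 \<Longrightarrow> \<forall>\<^sub>F i in F. (norm (X i - v))\<^sup>2 \<le> r + e"
  shows "v = c"
proof -
  have "(norm (c - v))\<^sup>2 \<le> 0 + e" if "e > 0" for e
    using near_centers_close[where F = F and X = X and r = r and u = c and v = v and e = "e/4"]
      c v[of "e/4"] that
    unfolding asymptotic_center_def by simp
  then have "(norm (c - v))\<^sup>2 \<le> 0"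
    by (rule field_le_epsilon)
  then show ?thesis by simp
qed

text \<open>Otherwise a small move of the centre towards the half-space would bring it closer to all of
  the late elements of \<open>X\<close> by a fixed amount.\<close>
lemma asymptotic_center_in_halfspace:
  assumes c: "asymptotic_center F X c r"
    and half: "\<And>e. e > 0 \<Longrightarrow> \<forall>\<^sub>F i in F. \<alpha> - e \<le> inner (X i) g"
  shows "\<alpha> \<le> inner c g"
proof (rule ccontr)
  assume "\<not> \<alpha> \<le> inner c g"
  define d where "d = \<alpha> - inner c g"
  \<comment> \<open>Moving by \<open>s *\<^sub>R g\<close> lowers the squared distance by about \<open>s * d - s\<^sup>2 * (norm g)\<^sup>2\<close>; this length
    keeps half of the linear term, and adding \<open>1\<close> to \<open>(norm g)\<^sup>2\<close> covers \<open>g = 0\<close>.\<close>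
  define s where "s = d / (2 * ((norm g)\<^sup>2 + 1))"
  have d: "d > 0" using \<open>\<not> \<alpha> \<le> inner c g\<close> by (simp add: d_def)
  have g1: "(norm g)\<^sup>2 + 1 > 0" by (simp add: add_nonneg_pos)
  have s: "s > 0" using d g1 by (simp add: s_def)
  have "s * (norm g)\<^sup>2 \<le> s * ((norm g)\<^sup>2 + 1)" using s by simp
  also have "\<dots> = d / 2" using g1 by (simp add: s_def field_simps)
  finally have "s * (s * (norm g)\<^sup>2) \<le> s * (d / 2)" using s by simp
  then have sg: "s\<^sup>2 * (norm g)\<^sup>2 \<le> s * d / 2" by (simp add: power2_eq_square mult.assoc)
  have "\<forall>\<^sub>F i in F. (norm (X i - c))\<^sup>2 \<le> r + s * d / 4"
    using c s d unfolding asymptotic_center_def by simp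
  moreover have "\<forall>\<^sub>F i in F. \<alpha> - d / 2 \<le> inner (X i) g"
    using half d by simp
  ultimately have "\<forall>\<^sub>F i in F. (norm (X i - (c + s *\<^sub>R g)))\<^sup>2 \<le> r - s * d / 4"
  proof eventually_elim
    case (elim i)
    have "inner (X i - c) g \<ge> d / 2" using elim(2) by (simp add: d_def inner_diff_left field_simps)
    then have "s * inner (X i - c) g \<ge> s * (d / 2)" using s by (intro mult_left_mono) auto
    moreover have "(norm (X i - (c + s *\<^sub>R g)))\<^sup>2
        = (norm (X i - c))\<^sup>2 - 2 * (s * inner (X i - c) g) + s\<^sup>2 * (norm g)\<^sup>2"
      unfolding power2_norm_eq_inner
      by (simp add: inner_diff inner_add inner_commute power2_eq_square algebra_simps)
    ultimately show ?case using elim(1) sg by simp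
  qed
  then have "r \<le> r - s * d / 4"
    using c unfolding asymptotic_center_def by blast
  then show False using mult_pos_pos[OF s d] by simp
qed

text \<open>The limit is the asymptotic centre \<open>c\<close> of the whole sequence. If \<open>X\<close> stayed in a half-space
  missing \<open>c\<close> infinitely often, the centre \<open>c'\<close> along those indices would lie in that half-space. But
  \<open>c\<close> and \<open>c'\<close> both belong to \<open>S\<close>, so the distances of \<open>X\<close> to each of them converge by Fejer
  monotonicity, and then the optimality of either centre makes both of them optimal for the whole
  sequence, that is, equal.\<close>
lemma fejer_weak_convergence:
  fixes X :: "nat \<Rightarrow> 'a::{real_inner, complete_space}" and H :: "('a \<times> real) set"
  defines "S \<equiv> {c. \<forall>(g, \<alpha>) \<in> H. \<alpha> \<le> inner c g}"
  assumes S_ne: "S \<noteq> {}"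
    and fejer: "\<And>c k. c \<in> S \<Longrightarrow> norm (X (Suc k) - c) \<le> norm (X k - c)"
    and half: "\<And>g \<alpha> e. (g, \<alpha>) \<in> H \<Longrightarrow> e > 0 \<Longrightarrow> \<forall>\<^sub>F k in sequentially. \<alpha> - e \<le> inner (X k) g"
  obtains c where "c \<in> S" and "weakly_converges X c"
proof -
  have dec: "norm (X k - c) \<le> norm (X 0 - c)" if "c \<in> S" for c k
    by (induction k) (use fejer[OF that] order_trans in auto)
  obtain s where s: "s \<in> S" using S_ne by blast
  have bdd: "norm (X k) \<le> norm (X 0 - s) + norm s" for k
    using dec[OF s, of k] norm_triangle_sub[of "X k" s] by simp
  have center_in_S: "c \<in> S" if "asymptotic_center F X c r" "F \<le> sequentially" for F c r
    unfolding S_def using asymptotic_center_in_halfspace[OF that(1)] half filter_leD[OF that(2)]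
    by blast
  have lim: "\<exists>L. (\<lambda>k. (norm (X k - c))\<^sup>2) \<longlonglongrightarrow> L" if "c \<in> S" for c
  proof -
    have "decseq (\<lambda>k. (norm (X k - c))\<^sup>2)"
      using fejer[OF that] by (intro decseq_SucI power_mono) auto
    then show ?thesis
      using decseq_convergent[of "\<lambda>k. (norm (X k - c))\<^sup>2" 0] by auto
  qed
  obtain c r where c: "asymptotic_center sequentially X c r"
    by (rule asymptotic_center_exists[OF sequentially_bot always_eventually[OF allI[OF bdd]]])
  have cS: "c \<in> S" by (rule center_in_S[OF c]) simp
  have upper: "\<forall>\<^sub>F k in sequentially. inner (X k) u < inner c u + e" if e: "e > 0" for u e
  proof (rule ccontr)
    assume not_ev: "\<not> ?thesis"
    define K where "K = {k. inner c u + e \<le> inner (X k) u}"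
    define G where "G = inf sequentially (principal K)"
    have G: "G \<noteq> bot"
    proof
      assume "G = bot"
      then have "\<forall>\<^sub>F k in G. False" by simp
      then have "\<forall>\<^sub>F k in sequentially. k \<notin> K"
        by (simp add: G_def eventually_inf_principal)
      then show False using not_ev by (simp add: K_def not_le)
    qed
    have le: "G \<le> sequentially" by (simp add: G_def)
    obtain c' r' where c': "asymptotic_center G X c' r'"
      by (rule asymptotic_center_exists[OF G always_eventually[OF allI[OF bdd]]])
    have c'S: "c' \<in> S" by (rule center_in_S[OF c' le])
    obtain L where L: "(\<lambda>k. (norm (X k - c))\<^sup>2) \<longlonglongrightarrow> L" using lim[OF cS] by blast
    obtain L' where L': "(\<lambda>k. (norm (X k - c'))\<^sup>2) \<longlonglongrightarrow> L'" using lim[OF c'S] by blast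
    have "L \<le> r"
    proof (rule field_le_epsilon)
      fix e :: real assume "e > 0"
      then have "\<forall>\<^sub>F k in sequentially. (norm (X k - c))\<^sup>2 \<le> r + e"
        using c unfolding asymptotic_center_def by blast
      with L show "L \<le> r + e" by (intro tendsto_upperbound[OF L]) auto
    qed
    moreover have "L' \<le> r'"
    proof (rule field_le_epsilon)
      fix e :: real assume "e > 0"
      then have "\<forall>\<^sub>F k in G. (norm (X k - c'))\<^sup>2 \<le> r' + e"
        using c' unfolding asymptotic_center_def by blast
      then show "L' \<le> r' + e"
        using tendsto_mono[OF le L'] G by (intro tendsto_upperbound) auto
    qed
    moreover have "r' \<le> L"
    proof (rule field_le_epsilon)
      fix e :: real assume "e > 0"
      then have "\<forall>\<^sub>F k in sequentially. (norm (X k - c))\<^sup>2 \<le> L + e"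
        using order_tendstoD(2)[OF L, of "L + e"] by (auto elim!: eventually_mono)
      then show "r' \<le> L + e"
        using c' filter_leD[OF le] unfolding asymptotic_center_def by blast
    qed
    ultimately have "L' \<le> r" by simp
    have "c' = c"
    proof (rule asymptotic_center_unique[OF c])
      fix e :: real assume "e > 0"
      then have "L' < r + e" using \<open>L' \<le> r\<close> by simp
      then show "\<forall>\<^sub>F k in sequentially. (norm (X k - c'))\<^sup>2 \<le> r + e"
        using order_tendstoD(2)[OF L', of "r + e"] by (auto elim!: eventually_mono)
    qed
    have "\<forall>\<^sub>F k in G. inner c u + e \<le> inner (X k) u"
      unfolding G_def eventually_inf_principal K_def by simp
    then have "inner c u + e \<le> inner c' u"
      by (intro asymptotic_center_in_halfspace[OF c']) (auto elim!: eventually_mono)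
    then show False using \<open>c' = c\<close> e by simp
  qed
  have "weakly_converges X c"
    unfolding weakly_converges_def
  proof (intro allI tendstoI)
    fix u :: 'a and e :: real assume "e > 0"
    from upper[OF this, of u] upper[OF this, of "- u"]
    show "\<forall>\<^sub>F k in sequentially. dist (inner (X k) u) (inner c u) < e"
      by eventually_elim (simp add: dist_real_def abs_less_iff)
  qed
  with cS show ?thesis by (rule that)
qed

lemma weakly_converges_perturb:
  assumes "weakly_converges X l" and "(\<lambda>k. Y k - X k) \<longlonglongrightarrow> 0"
  shows "weakly_converges Y l"
  unfolding weakly_converges_def
proof
  fix u
  have "(\<lambda>k. inner (X k) u + inner (Y k - X k) u) \<longlonglongrightarrow> inner l u + inner 0 u"
    using assms(1) unfolding weakly_converges_def
    by (intro tendsto_add tendsto_inner[OF assms(2)] tendsto_const) blast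
  then show "(\<lambda>k. inner (Y k) u) \<longlonglongrightarrow> inner l u" by (simp add: inner_diff_left)
qed

section \<open>Maximal monotone operators and their enlargements\<close>

text \<open>Maximality speaks about all monotone extensions. It suffices to test those that
  add a single point to the graph, which is what the enlargement with \<open>\<epsilon> = 0\<close> describes.\<close>
lemma maximal_monotone_iff_enlargement_0:
  "maximal_monotone T \<longleftrightarrow> (\<forall>z. enlargement T 0 z = T z)"
proof
  assume T: "maximal_monotone T"
  then have mono: "monotone_operator T" unfolding maximal_monotone_def by blast
  have "v \<in> T z" if v: "v \<in> enlargement T 0 z" for z v
  proof -
    define S where "S = T(z := insert v (T z))"
    have v': "inner (z - z') (v - v') \<ge> 0" "inner (z' - z) (v' - v) \<ge> 0" if "v' \<in> T z'" for z' v'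
    proof -
      show "inner (z - z') (v - v') \<ge> 0" using v that by (auto simp: enlargement_def)
      then show "inner (z' - z) (v' - v) \<ge> 0" by (simp add: inner_diff algebra_simps)
    qed
    have "monotone_operator S"
      using mono v' unfolding monotone_operator_def S_def by (auto split: if_splits)
    moreover have "\<forall>z. T z \<subseteq> S z" by (auto simp: S_def)
    ultimately have "S = T" using T unfolding maximal_monotone_def by blast
    then show ?thesis by (metis S_def fun_upd_same insertI1)
  qed
  moreover have "T z \<subseteq> enlargement T 0 z" for z
    using mono unfolding monotone_operator_def enlargement_def by auto
  ultimately show "\<forall>z. enlargement T 0 z = T z" by blast
next
  assume T: "\<forall>z. enlargement T 0 z = T z"
  have mono: "monotone_operator T"
    unfolding monotone_operator_def
  proof (intro allI impI)
    fix z z' v v' assume "v \<in> T z" "v' \<in> T z'"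
    then have "v \<in> enlargement T 0 z" using T by simp
    then show "0 \<le> inner (z - z') (v - v')" using \<open>v' \<in> T z'\<close> by (simp add: enlargement_def)
  qed
  have "S = T" if S: "monotone_operator S" and ext: "\<forall>z. T z \<subseteq> S z" for S
  proof -
    have "S z \<subseteq> enlargement T 0 z" for z
      using S ext unfolding monotone_operator_def enlargement_def by simp blast
    then show ?thesis using T ext by blast
  qed
  with mono show "maximal_monotone T" unfolding maximal_monotone_def by blast
qed

lemma maximal_monotone_memI:
  assumes "maximal_monotone T" and "\<And>z' v'. v' \<in> T z' \<Longrightarrow> 0 \<le> inner (z - z') (v - v')"
  shows "v \<in> T z"
proof -
  have "v \<in> enlargement T 0 z" using assms(2) by (simp add: enlargement_def)
  then show ?thesis using assms(1) by (simp add: maximal_monotone_iff_enlargement_0)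
qed

text \<open>If the inequality failed, the midpoint of \<open>(x1, v1)\<close> and \<open>(x2, v2)\<close> would have a strictly
  positive product with every point of the graph of \<open>T\<close>. By maximality it would then lie on the
  graph, and the product with itself is \<open>0\<close>.\<close>
lemma enlargement_almost_monotone:
  assumes T: "maximal_monotone T"
    and v1: "v1 \<in> enlargement T e1 x1" and v2: "v2 \<in> enlargement T e2 x2"
  shows "- 2 * (e1 + e2) \<le> inner (x1 - x2) (v1 - v2)"
proof (rule ccontr)
  assume neg: "\<not> ?thesis"
  define m where "m = (1/2) *\<^sub>R (x1 + x2)"
  define n where "n = (1/2) *\<^sub>R (v1 + v2)"
  have pos: "0 < inner (m - z') (n - v')" if "v' \<in> T z'" for z' v'
  proof -
    have "inner (m - z') (n - v') = inner (x1 - z') (v1 - v') / 2 + inner (x2 - z') (v2 - v') / 2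
        - inner (x1 - x2) (v1 - v2) / 4"
      unfolding m_def n_def by (simp add: inner_diff inner_add field_simps)
    moreover have "- e1 \<le> inner (x1 - z') (v1 - v')" "- e2 \<le> inner (x2 - z') (v2 - v')"
      using v1 v2 that unfolding enlargement_def by auto
    ultimately show ?thesis using neg by (simp add: field_simps)
  qed
  then have "n \<in> T m" using T by (intro maximal_monotone_memI) (auto intro: less_imp_le)
  from pos[OF this] show False by simp
qed

text \<open>The pair belonging to \<open>\<alpha> \<in> A s\<close> and \<open>\<beta> \<in> B q\<close> encodes the inequality
  \<open>0 \<le> \<langle>\<zeta> - s, - \<omega> - \<alpha>\<rangle> + \<langle>\<zeta> - q, \<omega> - \<beta>\<rangle>\<close>, which is affine in \<open>(\<zeta>, \<omega>)\<close> because the terms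
  \<open>\<langle>\<zeta>, \<omega>\<rangle>\<close> cancel.\<close>
definition solution_halfspaces ::
  "('a::real_inner \<Rightarrow> 'a set) \<Rightarrow> ('a \<Rightarrow> 'a set) \<Rightarrow> (('a \<times> 'a) \<times> real) set" where
  "solution_halfspaces A B =
     {((- (\<alpha> + \<beta>), s - q), - (inner s \<alpha> + inner q \<beta>)) | s \<alpha> q \<beta>. \<alpha> \<in> A s \<and> \<beta> \<in> B q}"

text \<open>The inequalities bound only the sum of an \<open>A\<close>-product and a \<open>B\<close>-product from below.
  If an \<open>A\<close>-product were negative, all \<open>B\<close>-products would be positive, which maximality excludes:
  \<open>(\<zeta>, \<omega>)\<close> would be on the graph of \<open>B\<close>, where its product with itself is \<open>0\<close>. So
  \<open>(\<zeta>, - \<omega>)\<close> is on the graph of \<open>A\<close>, and testing with this point, where the \<open>A\<close>-product is \<open>0\<close>,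
  leaves the maximality test for \<open>B\<close>.\<close>
lemma extended_solution_set_halfspaces:
  assumes A: "maximal_monotone A" and B: "maximal_monotone B"
  shows "extended_solution_set A B = {c. \<forall>(g, r) \<in> solution_halfspaces A B. r \<le> inner c g}"
proof (intro set_eqI)
  fix c :: "'a \<times> 'a"
  obtain \<zeta> \<omega> where c: "c = (\<zeta>, \<omega>)" by (cases c)
  have sum: "(- (inner s \<alpha> + inner q \<beta>) \<le> inner c (- (\<alpha> + \<beta>), s - q))
      \<longleftrightarrow> 0 \<le> inner (\<zeta> - s) (- \<omega> - \<alpha>) + inner (\<zeta> - q) (\<omega> - \<beta>)" for s \<alpha> q \<beta>
    unfolding c by (simp add: inner_diff inner_add inner_commute algebra_simps)
  have rhs: "c \<in> {c. \<forall>(g, r) \<in> solution_halfspaces A B. r \<le> inner c g} \<longleftrightarrow>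
      (\<forall>s q. \<forall>\<alpha> \<in> A s. \<forall>\<beta> \<in> B q. 0 \<le> inner (\<zeta> - s) (- \<omega> - \<alpha>) + inner (\<zeta> - q) (\<omega> - \<beta>))"
  proof -
    have "c \<in> {c. \<forall>(g, r) \<in> solution_halfspaces A B. r \<le> inner c g} \<longleftrightarrow>
        (\<forall>s q. \<forall>\<alpha> \<in> A s. \<forall>\<beta> \<in> B q.
          - (inner s \<alpha> + inner q \<beta>) \<le> inner c (- (\<alpha> + \<beta>), s - q))"
      unfolding solution_halfspaces_def by blast
    then show ?thesis unfolding sum .
  qed
  have monoA: "0 \<le> inner (p - s) (v - \<alpha>)" if "v \<in> A p" "\<alpha> \<in> A s" for p s v \<alpha>
    using A that unfolding maximal_monotone_def monotone_operator_def by blast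
  have monoB: "0 \<le> inner (p - s) (v - \<alpha>)" if "v \<in> B p" "\<alpha> \<in> B s" for p s v \<alpha>
    using B that unfolding maximal_monotone_def monotone_operator_def by blast
  show "c \<in> extended_solution_set A B \<longleftrightarrow>
      c \<in> {c. \<forall>(g, r) \<in> solution_halfspaces A B. r \<le> inner c g}"
    unfolding rhs
  proof
    assume "c \<in> extended_solution_set A B"
    then have "\<omega> \<in> B \<zeta>" "- \<omega> \<in> A \<zeta>" by (auto simp: c extended_solution_set_def)
    then show "\<forall>s q. \<forall>\<alpha> \<in> A s. \<forall>\<beta> \<in> B q.
        0 \<le> inner (\<zeta> - s) (- \<omega> - \<alpha>) + inner (\<zeta> - q) (\<omega> - \<beta>)"
      using monoA monoB by (simp add: add_nonneg_nonneg)
  next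
    assume nn: "\<forall>s q. \<forall>\<alpha> \<in> A s. \<forall>\<beta> \<in> B q.
        0 \<le> inner (\<zeta> - s) (- \<omega> - \<alpha>) + inner (\<zeta> - q) (\<omega> - \<beta>)"
    have inA: "- \<omega> \<in> A \<zeta>"
    proof (rule maximal_monotone_memI[OF A], rule ccontr)
      fix s \<alpha> assume "\<alpha> \<in> A s" and "\<not> 0 \<le> inner (\<zeta> - s) (- \<omega> - \<alpha>)"
      then have pos: "0 < inner (\<zeta> - q) (\<omega> - \<beta>)" if "\<beta> \<in> B q" for q \<beta>
        using nn that by (smt (verit))
      then have "\<omega> \<in> B \<zeta>" using B by (intro maximal_monotone_memI) (auto intro: less_imp_le)
      from pos[OF this] show False by simp
    qed
    moreover have "\<omega> \<in> B \<zeta>"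
    proof (rule maximal_monotone_memI[OF B])
      fix q \<beta> assume "\<beta> \<in> B q"
      then have "0 \<le> inner (\<zeta> - \<zeta>) (- \<omega> - - \<omega>) + inner (\<zeta> - q) (\<omega> - \<beta>)"
        using nn inA by blast
      then show "0 \<le> inner (\<zeta> - q) (\<omega> - \<beta>)" by simp
    qed
    ultimately show "c \<in> extended_solution_set A B" by (simp add: c extended_solution_set_def)
  qed
qed

section \<open>One step of the method\<close>

text \<open>The left side is the first-order decrease of the squared distance to \<open>(s, v)\<close> in the search
  direction \<open>(a + b, x - y)\<close>. On the right, the enlargement inequalities bound the two products from
  below, and the other terms do not depend on the solution.\<close>
lemma DR_step_identity:
  fixes z w a y b x s v :: "'a::real_inner"
  shows "2 * (inner (z - s) (a + b) + inner (w - v) (x - y)) =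
    2 * (inner (y - s) (a + v) + inner (x - s) (b - v)) + DR_rho 1 a y b x + (norm (a + w))\<^sup>2
    - 2 * inner (a + y - (z - w)) (a + b) - (norm (b + x - (y + w)))\<^sup>2"
  unfolding DR_rho_def power2_norm_eq_inner
  by (simp add: inner_diff inner_add inner_commute algebra_simps)

lemma DR_t_bounds:
  assumes "0 < \<sigma>" and "0 < \<nu>" and "0 \<le> DR_delta lam z w a y b x \<epsilon> \<mu>"
    and "DR_delta lam z w a y b x \<epsilon> \<mu> \<le> \<sigma>\<^sup>2 / 4 * DR_rho lam a y b x"
  shows "0 \<le> DR_t lam \<sigma> \<nu> z w a y b x \<epsilon> \<mu>" and "DR_t lam \<sigma> \<nu> z w a y b x \<epsilon> \<mu> \<le> \<nu>"
proof -
  let ?\<delta> = "DR_delta lam z w a y b x \<epsilon> \<mu>" and ?\<rho> = "DR_rho lam a y b x"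
  have \<rho>: "0 \<le> ?\<rho>" by (simp add: DR_rho_def)
  show "0 \<le> DR_t lam \<sigma> \<nu> z w a y b x \<epsilon> \<mu>"
    using assms by (simp add: DR_t_def)
  have "4 * ?\<delta> / (\<sigma>\<^sup>2 * ?\<rho>) \<le> 1"
    using assms(1,4) \<rho> by (auto simp: divide_le_eq_1 field_simps zero_less_mult_iff)
  then have "sqrt (4 * ?\<delta> / (\<sigma>\<^sup>2 * ?\<rho>)) \<le> 1" by simp
  moreover have "0 \<le> (norm (lam *\<^sub>R (a + w)))\<^sup>2 / ?\<rho>" using \<rho> by simp
  ultimately have "max 0 (sqrt (4 * ?\<delta> / (\<sigma>\<^sup>2 * ?\<rho>)) - (norm (lam *\<^sub>R (a + w)))\<^sup>2 / ?\<rho>) \<le> 1"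
    by linarith
  then show "DR_t lam \<sigma> \<nu> z w a y b x \<epsilon> \<mu> \<le> \<nu>"
    unfolding DR_t_def using assms(2) mult_left_mono[of _ 1 \<nu>] by auto
qed

text \<open>With step length \<open>1 - t\<close> the decrease of the squared distance is at least
  \<open>(1 - t) * (t * \<rho> + \<parallel>a + w\<parallel>\<^sup>2 - 2 * sqrt (\<delta> * \<rho>))\<close>. For \<open>t = 0\<close> the last factor may be negative;
  the defining formula of \<open>t\<close> is the correction that bounds it from below by
  \<open>(\<nu> - \<sigma>) * V + (1 - \<nu>) * \<parallel>a + w\<parallel>\<^sup>2\<close>, where \<open>V = 2 * sqrt (\<delta> * \<rho>) / \<sigma>\<close>, and \<open>V\<close> dominates
  \<open>4 * \<delta> / \<sigma>\<^sup>2\<close> by the error criterion.\<close>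
lemma DR_step_fejer:
  fixes z w a y b x s v :: "'a::real_inner"
  assumes \<sigma>: "0 < \<sigma>" "\<sigma> < \<nu>" and \<nu>: "\<nu> < 1" and \<epsilon>: "0 \<le> \<epsilon>" and \<mu>: "0 \<le> \<mu>"
    and err: "DR_delta 1 z w a y b x \<epsilon> \<mu> \<le> \<sigma>\<^sup>2 / 4 * DR_rho 1 a y b x"
    and A: "- \<epsilon> \<le> inner (y - s) (a + v)" and B: "- \<mu> \<le> inner (x - s) (b - v)"
  defines "t \<equiv> DR_t 1 \<sigma> \<nu> z w a y b x \<epsilon> \<mu>"
  shows "(norm ((z - (1 - t) *\<^sub>R (a + b), w - (1 - t) *\<^sub>R (x - y)) - (s, v)))\<^sup>2
      + (1 - \<nu>) * ((\<nu> - \<sigma>) * (4 / \<sigma>\<^sup>2) * DR_delta 1 z w a y b x \<epsilon> \<mu> + (1 - \<nu>) * (norm (a + w))\<^sup>2)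
    \<le> (norm ((z, w) - (s, v)))\<^sup>2"
proof -
  define \<delta> where "\<delta> = DR_delta 1 z w a y b x \<epsilon> \<mu>"
  define \<rho> where "\<rho> = DR_rho 1 a y b x"
  define U where "U = (norm (a + w))\<^sup>2"
  define n where "n = norm (a + y - (z - w))"
  define D where "D = sqrt \<delta>"
  define R where "R = sqrt \<rho>"
  have \<rho>0: "0 \<le> \<rho>" by (simp add: \<rho>_def DR_rho_def)
  have \<delta>_eq: "\<delta> = n\<^sup>2 + (norm (b + x - (y + w)))\<^sup>2 + 2 * (\<epsilon> + \<mu>)"
    by (simp add: \<delta>_def DR_delta_def n_def)
  have \<delta>0: "0 \<le> \<delta>" unfolding \<delta>_eq using \<epsilon> \<mu> by simp
  have DD: "D\<^sup>2 = \<delta>" and RR: "R\<^sup>2 = \<rho>" and D0: "0 \<le> D" and R0: "0 \<le> R"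
    using \<delta>0 \<rho>0 by (simp_all add: D_def R_def)
  have U0: "0 \<le> U" by (simp add: U_def)
  have "D\<^sup>2 \<le> (\<sigma> / 2 * R)\<^sup>2"
    using err by (simp add: DD RR power_mult_distrib power_divide \<delta>_def[symmetric] \<rho>_def[symmetric])
  then have DR: "D \<le> \<sigma> / 2 * R"
    by (rule power2_le_imp_le) (use \<sigma> R0 in simp)
  have "\<sigma> / 2 * R \<le> 1 * R" using \<sigma> \<nu> R0 by (intro mult_right_mono) auto
  with DR have DleR: "D \<le> R" by simp
  have "n\<^sup>2 \<le> D\<^sup>2" unfolding DD \<delta>_eq using \<epsilon> \<mu> by simp
  then have nD: "n \<le> D" using D0 by (rule power2_le_imp_le)
  have t1: "t \<le> \<nu>"
    unfolding t_def using \<sigma> \<delta>0 err by (intro DR_t_bounds(2)) (simp_all add: \<delta>_def)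
  define G where "G = 2 * (inner (z - s) (a + b) + inner (w - v) (x - y))"
  have gain: "\<rho> + U - 2 * (D * R) \<le> G"
  proof -
    have "inner (a + y - (z - w)) (a + b) \<le> n * norm (a + b)"
      unfolding n_def by (rule norm_cauchy_schwarz)
    also have "norm (a + b) \<le> R"
      unfolding R_def \<rho>_def DR_rho_def by (rule real_le_rsqrt) simp
    then have "n * norm (a + b) \<le> n * R" by (intro mult_left_mono) (auto simp: n_def)
    finally have "inner (a + y - (z - w)) (a + b) \<le> n * R" .
    \<comment> \<open>The function \<open>2 * n * R - n\<^sup>2\<close> of \<open>n\<close> increases up to \<open>R\<close>, so the worst case is \<open>n = D\<close>.\<close>
    moreover have "(R - D)\<^sup>2 \<le> (R - n)\<^sup>2" using nD DleR by (intro power_mono) auto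
    then have "2 * (n * R) - n\<^sup>2 \<le> 2 * (D * R) - D\<^sup>2"
      by (simp add: power2_diff algebra_simps)
    moreover have "G = 2 * (inner (y - s) (a + v) + inner (x - s) (b - v)) + \<rho> + U
        - 2 * inner (a + y - (z - w)) (a + b) - (norm (b + x - (y + w)))\<^sup>2"
      unfolding G_def \<rho>_def U_def by (rule DR_step_identity)
    moreover have "- 2 * (\<epsilon> + \<mu>) \<le> 2 * (inner (y - s) (a + v) + inner (x - s) (b - v))"
      using A B by argo
    ultimately show ?thesis using \<delta>_eq DD by argo
  qed
  have tcrit: "(\<nu> - \<sigma>) * (4 / \<sigma>\<^sup>2) * \<delta> + (1 - \<nu>) * U \<le> t * \<rho> + U - 2 * (D * R)"
  proof (cases "R = 0")
    \<comment> \<open>The error criterion then forces \<open>\<delta> = 0\<close>, and the vanishing residuals give \<open>a = - w\<close>.\<close>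
    case True
    then have "\<delta> = 0" "D = 0" using DR D0 DD by auto
    moreover have "U = 0"
    proof -
      have *: "\<rho> = 0" using True RR by simp
      have "(norm (a + b))\<^sup>2 = 0" "(norm (x - y))\<^sup>2 = 0"
        using * unfolding \<rho>_def DR_rho_def by (simp_all add: add_nonneg_eq_0_iff)
      moreover have "(norm (b + x - (y + w)))\<^sup>2 = 0"
        using \<open>\<delta> = 0\<close> \<epsilon> \<mu> zero_le_power2[of n] zero_le_power2[of "norm (b + x - (y + w))"]
        unfolding \<delta>_eq by argo
      ultimately have "a + b = 0" "x = y" "b + x = y + w" by auto
      then have "a + w = 0" by simp
      then show ?thesis by (simp add: U_def)
    qed
    ultimately show ?thesis using True RR by simp
  next
    case False
    then have Rpos: "0 < R" using R0 by simp
    have "\<not> (a + b = 0 \<and> x - y = 0)"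
      using False unfolding R_def \<rho>_def DR_rho_def by auto
    then have t: "t = \<nu> * max 0 (sqrt (4 * \<delta> / (\<sigma>\<^sup>2 * \<rho>)) - U / \<rho>)"
      unfolding t_def DR_t_def \<delta>_def \<rho>_def U_def by (simp only: if_False scaleR_one)
    have "4 * \<delta> / (\<sigma>\<^sup>2 * \<rho>) = (2 * D / (\<sigma> * R))\<^sup>2"
      by (simp add: DD[symmetric] RR[symmetric] power_mult_distrib power_divide)
    then have root: "sqrt (4 * \<delta> / (\<sigma>\<^sup>2 * \<rho>)) = 2 * D / (\<sigma> * R)"
      using D0 Rpos \<sigma> by simp
    define V where "V = 2 * (D * R) / \<sigma>"
    have KV: "2 * (D * R) = \<sigma> * V" using \<sigma> by (simp add: V_def)
    have "V - U = (2 * D / (\<sigma> * R) - U / \<rho>) * \<rho>"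
      using Rpos \<sigma> by (simp add: V_def RR[symmetric] power2_eq_square field_simps)
    also have "\<dots> \<le> max 0 (2 * D / (\<sigma> * R) - U / \<rho>) * \<rho>"
      using \<rho>0 by (intro mult_right_mono) auto
    finally have "\<nu> * (V - U) \<le> \<nu> * (max 0 (2 * D / (\<sigma> * R) - U / \<rho>) * \<rho>)"
      using \<sigma> by (intro mult_left_mono) auto
    then have "\<nu> * (V - U) \<le> t * \<rho>"
      unfolding t root by (simp add: mult.assoc)
    then have 1: "(\<nu> - \<sigma>) * V + (1 - \<nu>) * U \<le> t * \<rho> + U - 2 * (D * R)"
      unfolding KV by (simp add: algebra_simps)
    have "4 / \<sigma>\<^sup>2 * \<delta> = (2 / \<sigma>) * (D * (2 / \<sigma> * D))"
      by (simp add: DD[symmetric] power2_eq_square)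
    also have "\<dots> \<le> (2 / \<sigma>) * (D * R)"
      using DR \<sigma> D0 by (intro mult_left_mono) (auto simp: field_simps)
    also have "\<dots> = V" by (simp add: V_def)
    finally have "(\<nu> - \<sigma>) * (4 / \<sigma>\<^sup>2 * \<delta>) \<le> (\<nu> - \<sigma>) * V"
      using \<sigma> by (intro mult_left_mono) auto
    with 1 show ?thesis unfolding mult.assoc[of "\<nu> - \<sigma>"] by linarith
  qed
  have expand: "(norm ((z - (1 - t) *\<^sub>R (a + b), w - (1 - t) *\<^sub>R (x - y)) - (s, v)))\<^sup>2
      = (norm ((z, w) - (s, v)))\<^sup>2 - (1 - t) * G + (1 - t)\<^sup>2 * \<rho>"
  proof -
    have sq: "(norm (p - r *\<^sub>R g - q))\<^sup>2 = (norm (p - q))\<^sup>2 - r * (2 * inner (p - q) g) + r\<^sup>2 * (norm g)\<^sup>2"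
      for p q g :: 'a and r
      unfolding power2_norm_eq_inner
      by (simp add: inner_diff inner_add inner_commute power2_eq_square algebra_simps)
    have pair: "(norm ((p, p') - (s, v)))\<^sup>2 = (norm (p - s))\<^sup>2 + (norm (p' - v))\<^sup>2" for p p'
      by (simp add: norm_Pair)
    show ?thesis
      unfolding pair sq G_def \<rho>_def DR_rho_def scaleR_one by argo
  qed
  define Q where "Q = (\<nu> - \<sigma>) * (4 / \<sigma>\<^sup>2) * \<delta> + (1 - \<nu>) * U"
  have Q0: "0 \<le> Q" unfolding Q_def using \<sigma> \<nu> \<delta>0 U0 by simp
  have "(1 - \<nu>) * Q \<le> (1 - t) * Q" using t1 Q0 by (intro mult_right_mono) auto
  also have "\<dots> \<le> (1 - t) * (t * \<rho> + U - 2 * (D * R))"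
    using tcrit t1 \<nu> unfolding Q_def by (intro mult_left_mono) auto
  also have "\<dots> \<le> (1 - t) * (G - (1 - t) * \<rho>)"
    using gain t1 \<nu> by (intro mult_left_mono) (auto simp: algebra_simps)
  also have "\<dots> = (1 - t) * G - (1 - t)\<^sup>2 * \<rho>"
    by (simp add: power2_eq_square algebra_simps)
  finally show ?thesis
    unfolding expand Q_def \<delta>_def U_def by simp
qed

section \<open>Runs with unit step size\<close>

lemma null_add:
  fixes X Y Z :: "nat \<Rightarrow> 'a::real_normed_vector"
  assumes "X \<longlonglongrightarrow> 0" and "Y \<longlonglongrightarrow> 0" and "\<And>k. Z k = X k + Y k"
  shows "Z \<longlonglongrightarrow> 0"
proof -
  have "Z = (\<lambda>k. X k + Y k)" by (rule ext) (rule assms(3))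
  then show ?thesis using tendsto_add_zero[OF assms(1,2)] by simp
qed

lemma null_diff:
  fixes X Y Z :: "nat \<Rightarrow> 'a::real_normed_vector"
  assumes "X \<longlonglongrightarrow> 0" and "Y \<longlonglongrightarrow> 0" and "\<And>k. Z k = X k - Y k"
  shows "Z \<longlonglongrightarrow> 0"
  by (rule null_add[OF assms(1) tendsto_minus[OF assms(2), unfolded minus_zero]]) (simp add: assms(3))

lemma nonneg_squeeze_zero:
  fixes f g :: "nat \<Rightarrow> real"
  assumes "\<And>k. 0 \<le> f k" and "\<And>k. f k \<le> g k" and "g \<longlonglongrightarrow> 0"
  shows "f \<longlonglongrightarrow> 0"
  using assms by (intro tendsto_sandwich[of "\<lambda>_. 0" f]) (auto intro!: always_eventually)

lemma norm_power2_squeeze_zero: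
  fixes X :: "nat \<Rightarrow> 'a::real_normed_vector"
  assumes "\<And>k. (norm (X k))\<^sup>2 \<le> g k" and "g \<longlonglongrightarrow> 0"
  shows "X \<longlonglongrightarrow> 0"
proof -
  have "(\<lambda>k. (norm (X k))\<^sup>2) \<longlonglongrightarrow> 0"
    by (rule nonneg_squeeze_zero[OF _ assms]) simp
  from tendsto_real_sqrt[OF this] show ?thesis by (simp add: tendsto_norm_zero_iff)
qed

lemma fejer_gain_vanishes:
  fixes d e :: "nat \<Rightarrow> real"
  assumes "\<And>k. 0 \<le> d k" and "\<And>k. 0 \<le> e k" and step: "\<And>k. d (Suc k) + e k \<le> d k"
  shows "e \<longlonglongrightarrow> 0"
proof -
  have "decseq d"
    by (rule decseq_SucI) (use step assms(2) in \<open>metis add.commute add_increasing order_trans order_refl\<close>)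
  then obtain L where L: "d \<longlonglongrightarrow> L" using decseq_convergent assms(1) by metis
  have "(\<lambda>k. d k - d (Suc k)) \<longlonglongrightarrow> L - L"
    by (intro tendsto_diff L LIMSEQ_Suc)
  then have "(\<lambda>k. d k - d (Suc k)) \<longlonglongrightarrow> 0" by simp
  then show ?thesis
    by (rule nonneg_squeeze_zero[rotated 2]) (use assms(2) step in \<open>auto simp: algebra_simps\<close>)
qed

lemma perturbed_contraction_vanishes:
  fixes f h :: "nat \<Rightarrow> real"
  assumes f: "\<And>k. 0 \<le> f k" and q: "0 \<le> q" "q < 1" and h: "h \<longlonglongrightarrow> 0"
    and step: "\<And>k. f (Suc k) \<le> q * f k + h k"
  shows "f \<longlonglongrightarrow> 0"
proof (rule tendstoI)
  fix e :: real assume e: "0 < e"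
  then have "0 < (1 - q) * (e / 2)" using q by simp
  from order_tendstoD(2)[OF h this] obtain N where N: "\<And>k. N \<le> k \<Longrightarrow> h k < (1 - q) * (e / 2)"
    unfolding eventually_sequentially by blast
  have bound: "f (j + N) \<le> e / 2 + q ^ j * f N" for j
  proof (induction j)
    case 0
    then show ?case using e by simp
  next
    case (Suc j)
    have "f (Suc j + N) \<le> q * f (j + N) + (1 - q) * (e / 2)"
      using step[of "j + N"] N[of "j + N"] by simp
    also have "q * f (j + N) \<le> q * (e / 2 + q ^ j * f N)"
      using Suc q by (intro mult_left_mono) auto
    finally show ?case by (simp add: field_simps)
  qed
  have "(\<lambda>j. e / 2 + q ^ j * f N) \<longlonglongrightarrow> e / 2 + 0 * f N"
    using q by (intro tendsto_intros LIMSEQ_realpow_zero) auto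
  then have "\<forall>\<^sub>F j in sequentially. e / 2 + q ^ j * f N < e"
    by (rule order_tendstoD(2)) (use e in simp)
  then have "\<forall>\<^sub>F j in sequentially. f (j + N) < e"
    by (rule eventually_mono) (use bound le_less_trans in blast)
  then have "\<forall>\<^sub>F k in sequentially. f k < e"
    by (simp add: eventually_sequentially_seg[of "\<lambda>k. f k < e" N])
  then show "\<forall>\<^sub>F k in sequentially. dist (f k) 0 < e"
    by (rule eventually_mono) (use f in simp)
qed

lemma tendsto_zero_inner_bounded:
  fixes X Y :: "nat \<Rightarrow> 'a::real_inner"
  assumes "\<And>k. norm (Y k) \<le> M" and X: "X \<longlonglongrightarrow> 0"
  shows "(\<lambda>k. inner (Y k) (X k)) \<longlonglongrightarrow> 0"
proof (rule Lim_null_comparison)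
  show "\<forall>\<^sub>F k in sequentially. norm (inner (Y k) (X k)) \<le> M * norm (X k)"
    using assms(1) by (intro always_eventually allI)
      (metis Cauchy_Schwarz_ineq2 mult_right_mono norm_ge_zero order_trans real_norm_def)
  have "(\<lambda>k. M * norm (X k)) \<longlonglongrightarrow> M * norm (0::'a)"
    by (intro tendsto_intros X)
  then show "(\<lambda>k. M * norm (X k)) \<longlonglongrightarrow> 0" by simp
qed

lemma tendsto_zero_scaleR_bounded:
  fixes X :: "nat \<Rightarrow> 'a::real_normed_vector"
  assumes "\<And>k. \<bar>c k\<bar> \<le> M" and X: "X \<longlonglongrightarrow> 0"
  shows "(\<lambda>k. c k *\<^sub>R X k) \<longlonglongrightarrow> 0"
proof (rule Lim_null_comparison)
  show "\<forall>\<^sub>F k in sequentially. norm (c k *\<^sub>R X k) \<le> M * norm (X k)"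
    using assms(1) by (intro always_eventually allI) (simp add: mult_right_mono)
  have "(\<lambda>k. M * norm (X k)) \<longlonglongrightarrow> M * norm (0::'a)"
    by (intro tendsto_intros X)
  then show "(\<lambda>k. M * norm (X k)) \<longlonglongrightarrow> 0" by simp
qed

text \<open>A run is indexed so that step \<open>Suc k\<close> starts from \<open>(z k, w k)\<close>; \<open>\<delta> k\<close> and \<open>\<tau> k\<close> below belong
  to that step.\<close>
locale unit_step_DR =
  fixes A B :: "'a::{real_inner, complete_space} \<Rightarrow> 'a set"
    and \<sigma> \<nu> :: real
    and z w a y b x :: "nat \<Rightarrow> 'a"
    and \<epsilon> \<mu> :: "nat \<Rightarrow> real"
  assumes A_max: "maximal_monotone A" and B_max: "maximal_monotone B"
    and \<sigma>_pos: "0 < \<sigma>" and \<sigma>_less: "\<sigma> < \<nu>" and \<nu>_less: "\<nu> < 1"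
    and run: "inexact_DR A B 1 \<sigma> \<nu> z w a y b x \<epsilon> \<mu>"
    and solvable: "extended_solution_set A B \<noteq> {}"
begin

definition \<delta> :: "nat \<Rightarrow> real" where
  "\<delta> k = DR_delta 1 (z k) (w k) (a (Suc k)) (y (Suc k)) (b (Suc k)) (x (Suc k))
     (\<epsilon> (Suc k)) (\<mu> (Suc k))"

definition \<tau> :: "nat \<Rightarrow> real" where
  "\<tau> k = DR_t 1 \<sigma> \<nu> (z k) (w k) (a (Suc k)) (y (Suc k)) (b (Suc k)) (x (Suc k))
     (\<epsilon> (Suc k)) (\<mu> (Suc k))"

lemma step:
  shows \<epsilon>_nonneg: "0 \<le> \<epsilon> (Suc k)" and \<mu>_nonneg: "0 \<le> \<mu> (Suc k)"
    and a_in: "a (Suc k) \<in> enlargement A (\<epsilon> (Suc k)) (y (Suc k))"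
    and b_in: "b (Suc k) \<in> enlargement B (\<mu> (Suc k)) (x (Suc k))"
    and \<delta>_le: "\<delta> k \<le> \<sigma>\<^sup>2 / 4 * DR_rho 1 (a (Suc k)) (y (Suc k)) (b (Suc k)) (x (Suc k))"
    and z_Suc: "z (Suc k) = z k - (1 - \<tau> k) *\<^sub>R (a (Suc k) + b (Suc k))"
    and w_Suc: "w (Suc k) = w k - (1 - \<tau> k) *\<^sub>R (x (Suc k) - y (Suc k))"
  using run[unfolded inexact_DR_def, rule_format, of "Suc k"]
  unfolding \<delta>_def \<tau>_def by (simp_all add: Let_def)

lemma \<delta>_eq:
  "\<delta> k = (norm (a (Suc k) + y (Suc k) - (z k - w k)))\<^sup>2
    + (norm (b (Suc k) + x (Suc k) - (y (Suc k) + w k)))\<^sup>2 + 2 * (\<epsilon> (Suc k) + \<mu> (Suc k))"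
  by (simp add: \<delta>_def DR_delta_def)

lemma \<delta>_nonneg: "0 \<le> \<delta> k"
  using \<epsilon>_nonneg[of k] \<mu>_nonneg[of k] by (simp add: \<delta>_eq)

lemma \<tau>_nonneg: "0 \<le> \<tau> k" and \<tau>_le: "\<tau> k \<le> \<nu>"
  unfolding \<tau>_def using \<delta>_nonneg[of k] \<delta>_le[of k] \<sigma>_pos \<sigma>_less
  by (intro DR_t_bounds; simp add: \<delta>_def)+

lemma step_length_le: "\<bar>1 - \<tau> k\<bar> \<le> 1"
  using \<tau>_nonneg[of k] \<tau>_le[of k] \<nu>_less by simp

lemma fejer_gain:
  assumes "c \<in> extended_solution_set A B"
  shows "(norm ((z (Suc k), w (Suc k)) - c))\<^sup>2
      + (1 - \<nu>) * ((\<nu> - \<sigma>) * (4 / \<sigma>\<^sup>2) * \<delta> k + (1 - \<nu>) * (norm (a (Suc k) + w k))\<^sup>2)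
    \<le> (norm ((z k, w k) - c))\<^sup>2"
proof -
  obtain s v where c: "c = (s, v)" by (cases c)
  then have "v \<in> B s" "- v \<in> A s" using assms by (auto simp: extended_solution_set_def)
  then have "- \<epsilon> (Suc k) \<le> inner (y (Suc k) - s) (a (Suc k) + v)"
    and "- \<mu> (Suc k) \<le> inner (x (Suc k) - s) (b (Suc k) - v)"
    using a_in[of k] b_in[of k] unfolding enlargement_def by force+
  then show ?thesis
    unfolding c z_Suc w_Suc \<delta>_def \<tau>_def
    using \<epsilon>_nonneg \<mu>_nonneg \<delta>_le[of k] \<sigma>_pos \<sigma>_less \<nu>_less
    by (intro DR_step_fejer) (simp_all add: \<delta>_def)
qed

lemma fejer:
  assumes "c \<in> extended_solution_set A B"
  shows "norm ((z (Suc k), w (Suc k)) - c) \<le> norm ((z k, w k) - c)"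
proof -
  have "0 \<le> (1 - \<nu>) * ((\<nu> - \<sigma>) * (4 / \<sigma>\<^sup>2) * \<delta> k + (1 - \<nu>) * (norm (a (Suc k) + w k))\<^sup>2)"
    using \<sigma>_less \<nu>_less \<delta>_nonneg[of k] by simp
  then have "(norm ((z (Suc k), w (Suc k)) - c))\<^sup>2 \<le> (norm ((z k, w k) - c))\<^sup>2"
    using fejer_gain[OF assms, of k] by argo
  then show ?thesis by (rule power2_le_imp_le) simp
qed

lemma iterates_bounded:
  obtains M where "\<And>k. norm (z k) \<le> M" and "\<And>k. norm (w k) \<le> M"
proof -
  obtain c where c: "c \<in> extended_solution_set A B" using solvable by blast
  have "norm ((z k, w k) - c) \<le> norm ((z 0, w 0) - c)" for k
    by (induction k) (use fejer[OF c] order_trans in blast)+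
  then have M: "norm (z k, w k) \<le> norm ((z 0, w 0) - c) + norm c" for k
    using norm_triangle_sub[of "(z k, w k)" c] by (smt (verit))
  show ?thesis
  proof (rule that)
    show "norm (z k) \<le> norm ((z 0, w 0) - c) + norm c" for k
      using M[of k] norm_fst_le[of "z k" "w k"] by simp
    show "norm (w k) \<le> norm ((z 0, w 0) - c) + norm c" for k
      using M[of k] norm_snd_le[of "w k" "z k"] by simp
  qed
qed

lemma gain_vanishes:
  shows \<delta>_tendsto: "\<delta> \<longlonglongrightarrow> 0" and aw: "(\<lambda>k. a (Suc k) + w k) \<longlonglongrightarrow> 0"
proof -
  obtain c where c: "c \<in> extended_solution_set A B" using solvable by blast
  define C where "C = (1 - \<nu>) * ((\<nu> - \<sigma>) * (4 / \<sigma>\<^sup>2))"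
  define C' where "C' = (1 - \<nu>) * (1 - \<nu>)"
  define gain where "gain k = C * \<delta> k + C' * (norm (a (Suc k) + w k))\<^sup>2" for k
  have C: "0 < C" "0 < C'" unfolding C_def C'_def using \<sigma>_pos \<sigma>_less \<nu>_less by simp_all
  have gain0: "0 \<le> gain k" for k
    unfolding gain_def using C \<delta>_nonneg[of k] by simp
  have gain: "gain \<longlonglongrightarrow> 0"
  proof (rule fejer_gain_vanishes)
    show "(norm ((z (Suc k), w (Suc k)) - c))\<^sup>2 + gain k \<le> (norm ((z k, w k) - c))\<^sup>2" for k
      using fejer_gain[OF c, of k] unfolding gain_def C_def C'_def by (simp add: algebra_simps)
  qed (use gain0 in auto)
  then have lim: "(\<lambda>k. gain k / C) \<longlonglongrightarrow> 0" "(\<lambda>k. gain k / C') \<longlonglongrightarrow> 0"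
    using tendsto_divide[OF gain tendsto_const, of C] tendsto_divide[OF gain tendsto_const, of C'] C
    by simp_all
  have "\<delta> k \<le> gain k / C" "(norm (a (Suc k) + w k))\<^sup>2 \<le> gain k / C'" for k
    using C \<delta>_nonneg[of k] by (simp_all add: gain_def field_simps)
  note le = this
  show "\<delta> \<longlonglongrightarrow> 0" and "(\<lambda>k. a (Suc k) + w k) \<longlonglongrightarrow> 0"
    by (rule nonneg_squeeze_zero[OF \<delta>_nonneg le(1) lim(1)] norm_power2_squeeze_zero[OF le(2) lim(2)])+
qed

lemma residuals_vanish:
  shows res_A: "(\<lambda>k. a (Suc k) + y (Suc k) - (z k - w k)) \<longlonglongrightarrow> 0"
    and res_B: "(\<lambda>k. b (Suc k) + x (Suc k) - (y (Suc k) + w k)) \<longlonglongrightarrow> 0"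
    and \<epsilon>_tendsto: "(\<lambda>k. \<epsilon> (Suc k)) \<longlonglongrightarrow> 0" and \<mu>_tendsto: "(\<lambda>k. \<mu> (Suc k)) \<longlonglongrightarrow> 0"
proof -
  have le: "(norm (a (Suc k) + y (Suc k) - (z k - w k)))\<^sup>2 \<le> \<delta> k"
    "(norm (b (Suc k) + x (Suc k) - (y (Suc k) + w k)))\<^sup>2 \<le> \<delta> k"
    "\<epsilon> (Suc k) \<le> \<delta> k" "\<mu> (Suc k) \<le> \<delta> k" for k
    using \<epsilon>_nonneg[of k] \<mu>_nonneg[of k]
      zero_le_power2[of "norm (a (Suc k) + y (Suc k) - (z k - w k))"]
      zero_le_power2[of "norm (b (Suc k) + x (Suc k) - (y (Suc k) + w k))"]
    unfolding \<delta>_eq by argo+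
  show "(\<lambda>k. a (Suc k) + y (Suc k) - (z k - w k)) \<longlonglongrightarrow> 0"
    and "(\<lambda>k. b (Suc k) + x (Suc k) - (y (Suc k) + w k)) \<longlonglongrightarrow> 0"
    by (rule norm_power2_squeeze_zero[OF le(1) \<delta>_tendsto]
        norm_power2_squeeze_zero[OF le(2) \<delta>_tendsto])+
  show "(\<lambda>k. \<epsilon> (Suc k)) \<longlonglongrightarrow> 0" and "(\<lambda>k. \<mu> (Suc k)) \<longlonglongrightarrow> 0"
    by (rule nonneg_squeeze_zero[OF \<epsilon>_nonneg le(3) \<delta>_tendsto]
        nonneg_squeeze_zero[OF \<mu>_nonneg le(4) \<delta>_tendsto])+
qed

lemma y_near_z: "(\<lambda>k. y (Suc k) - z k) \<longlonglongrightarrow> 0"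
  by (rule null_diff[OF res_A aw]) simp

lemma gaps_cancel: "(\<lambda>k. (a (Suc k) + b (Suc k)) + (x (Suc k) - y (Suc k))) \<longlonglongrightarrow> 0"
  by (rule null_add[OF res_B aw]) simp

text \<open>Write \<open>P\<close> and \<open>Q\<close> for the increments of \<open>x\<close> and \<open>b\<close>. Their sum is a null sequence \<open>E\<close>, since
  \<open>x + b\<close> follows \<open>z + w\<close>, which changes by a bounded multiple of \<open>(a + b) + (x - y)\<close>. As
  \<open>\<langle>P, Q\<rangle>\<close> is almost nonnegative, \<open>\<parallel>P\<parallel>\<^sup>2 \<le> \<langle>P, E\<rangle>\<close> up to a null sequence, so \<open>P\<close> vanishes.\<close>
lemma x_steps_vanish: "(\<lambda>k. x (Suc (Suc k)) - x (Suc k)) \<longlonglongrightarrow> 0"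
proof -
  define q where "q k = x (Suc k) + b (Suc k) - (z k + w k)" for k
  define g where "g k = (a (Suc k) + b (Suc k)) + (x (Suc k) - y (Suc k))" for k
  define E where "E k = q (Suc k) - q k - (1 - \<tau> k) *\<^sub>R g k" for k
  define m where "m k = 2 * (\<mu> (Suc (Suc k)) + \<mu> (Suc k))" for k
  have q: "q \<longlonglongrightarrow> 0"
    by (rule null_add[OF res_B y_near_z]) (simp add: q_def)
  have g: "g \<longlonglongrightarrow> 0"
    using gaps_cancel unfolding g_def .
  have "E \<longlonglongrightarrow> 0 - 0 - 0"
    unfolding E_def
    by (intro tendsto_diff LIMSEQ_Suc[OF q] q tendsto_zero_scaleR_bounded[where M = 1]
        step_length_le g)
  then have E0: "(\<lambda>k. (norm (E k))\<^sup>2) \<longlonglongrightarrow> 0"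
    using tendsto_power[OF tendsto_norm, of E 0 sequentially 2] by simp
  have m0: "m \<longlonglongrightarrow> 2 * (0 + 0)"
    unfolding m_def by (intro tendsto_intros \<mu>_tendsto LIMSEQ_Suc[OF \<mu>_tendsto])
  have bound: "(norm (x (Suc (Suc k)) - x (Suc k)))\<^sup>2 \<le> (norm (E k))\<^sup>2 + 2 * m k" for k
  proof -
    define P where "P = x (Suc (Suc k)) - x (Suc k)"
    have "b (Suc (Suc k)) - b (Suc k) = E k - P"
      unfolding E_def q_def g_def P_def z_Suc[of k] w_Suc[of k]
      by (simp add: algebra_simps)
    moreover have "- 2 * (\<mu> (Suc (Suc k)) + \<mu> (Suc k))
        \<le> inner (x (Suc (Suc k)) - x (Suc k)) (b (Suc (Suc k)) - b (Suc k))"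
      by (rule enlargement_almost_monotone[OF B_max b_in b_in])
    ultimately have "- m k \<le> inner P (E k - P)"
      unfolding m_def P_def[symmetric] by simp
    then have 1: "(norm P)\<^sup>2 \<le> inner P (E k) + m k"
      by (simp add: inner_diff_right power2_norm_eq_inner)
    have "0 \<le> (norm (P - E k))\<^sup>2" by simp
    also have "\<dots> = (norm P)\<^sup>2 + (norm (E k))\<^sup>2 - 2 * inner P (E k)"
      unfolding power2_norm_eq_inner by (simp add: inner_diff inner_commute)
    finally show ?thesis using 1 unfolding P_def by argo
  qed
  have "(\<lambda>k. (norm (E k))\<^sup>2 + 2 * m k) \<longlonglongrightarrow> 0 + 2 * (2 * (0 + 0))"
    by (intro tendsto_add tendsto_mult tendsto_const E0 m0)
  then have "(\<lambda>k. (norm (E k))\<^sup>2 + 2 * m k) \<longlonglongrightarrow> 0" by simp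
  then show ?thesis by (rule norm_power2_squeeze_zero[OF bound])
qed

text \<open>Replacing \<open>y\<close> by the previous \<open>z\<close> and \<open>a + b\<close> by \<open>- (x - y)\<close>, both up to null sequences, the
  next gap becomes the part \<open>\<tau> k\<close> of the present gap that the shortened step left over. So the gap
  contracts by the factor \<open>\<nu>\<close> up to a null sequence.\<close>
lemma xy_gap_vanishes: "(\<lambda>k. x (Suc k) - y (Suc k)) \<longlonglongrightarrow> 0"
proof -
  define d where "d k = x (Suc k) - y (Suc k)" for k
  define g where "g k = (a (Suc k) + b (Suc k)) + (x (Suc k) - y (Suc k))" for k
  define h where "h k = (x (Suc (Suc k)) - x (Suc k)) - (y (Suc (Suc k)) - z (Suc k))
      + (y (Suc k) - z k) + (1 - \<tau> k) *\<^sub>R g k" for k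
  have "h \<longlonglongrightarrow> 0 - 0 + 0 + 0"
    unfolding h_def
    by (intro tendsto_diff tendsto_add x_steps_vanish y_near_z LIMSEQ_Suc[OF y_near_z]
        tendsto_zero_scaleR_bounded[where M = 1] step_length_le gaps_cancel[folded g_def])
  then have h0: "(\<lambda>k. norm (h k)) \<longlonglongrightarrow> 0" by (simp add: tendsto_norm_zero)
  have d_Suc: "d (Suc k) = \<tau> k *\<^sub>R d k + h k" for k
    unfolding d_def h_def g_def z_Suc[of k] by (simp add: algebra_simps)
  have "(\<lambda>k. norm (d k)) \<longlonglongrightarrow> 0"
  proof (rule perturbed_contraction_vanishes[where q = \<nu>])
    show "norm (d (Suc k)) \<le> \<nu> * norm (d k) + norm (h k)" for k
    proof -
      have "norm (d (Suc k)) \<le> \<tau> k * norm (d k) + norm (h k)"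
        unfolding d_Suc using norm_triangle_ineq[of "\<tau> k *\<^sub>R d k" "h k"] \<tau>_nonneg[of k] by simp
      also have "\<tau> k * norm (d k) \<le> \<nu> * norm (d k)"
        using \<tau>_le by (intro mult_right_mono) auto
      finally show ?thesis by simp
    qed
  qed (use h0 \<sigma>_pos \<sigma>_less \<nu>_less in auto)
  then show ?thesis unfolding d_def by (simp add: tendsto_norm_zero_iff)
qed

lemma ab_gap_vanishes: "(\<lambda>k. a (Suc k) + b (Suc k)) \<longlonglongrightarrow> 0"
  by (rule null_diff[OF gaps_cancel xy_gap_vanishes]) simp

lemma b_near_w: "(\<lambda>k. b (Suc k) - w k) \<longlonglongrightarrow> 0"
  by (rule null_diff[OF ab_gap_vanishes aw]) simp

lemma x_near_z: "(\<lambda>k. x (Suc k) - z k) \<longlonglongrightarrow> 0"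
  by (rule null_add[OF xy_gap_vanishes y_near_z]) simp

text \<open>At \<open>(y, a)\<close> and \<open>(x, b)\<close> the enlargement inequalities give the desired bound up to
  \<open>\<epsilon> + \<mu>\<close>. Passing to \<open>(z, w)\<close> changes the affine part by a null sequence; the quadratic part
  \<open>\<langle>y, a\<rangle> + \<langle>x, b\<rangle> = \<langle>y, a + b\<rangle> + \<langle>x - y, b\<rangle>\<close> vanishes because \<open>y\<close> and \<open>b\<close> stay near the bounded
  sequences \<open>z\<close> and \<open>w\<close> while both gaps tend to \<open>0\<close>.\<close>
lemma iterates_near_halfspaces:
  assumes "(g, r) \<in> solution_halfspaces A B" and "e > 0"
  shows "\<forall>\<^sub>F k in sequentially. r - e \<le> inner (z k, w k) g"
proof -
  obtain s \<alpha> q \<beta> where g: "g = (- (\<alpha> + \<beta>), s - q)" and r: "r = - (inner s \<alpha> + inner q \<beta>)"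
    and \<alpha>: "\<alpha> \<in> A s" and \<beta>: "\<beta> \<in> B q"
    using assms(1) unfolding solution_halfspaces_def by blast
  obtain M where z_bd: "\<And>k. norm (z k) \<le> M" and w_bd: "\<And>k. norm (w k) \<le> M"
    using iterates_bounded by metis
  \<comment> \<open>The excess over \<open>r\<close> at \<open>(z k, w k)\<close> minus the two enlargement products and the two errors, with
    the products \<open>\<langle>y, a + b\<rangle>\<close> and \<open>\<langle>b, x - y\<rangle>\<close> split into a bounded sequence and a null sequence.\<close>
  define h where "h k =
      - (inner (z k) (a (Suc k) + b (Suc k)) + inner (y (Suc k) - z k) (a (Suc k) + b (Suc k))
         + inner (w k) (x (Suc k) - y (Suc k)) + inner (b (Suc k) - w k) (x (Suc k) - y (Suc k)))
      + inner (y (Suc k) - z k) \<alpha> + inner (x (Suc k) - z k) \<beta>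
      + inner (a (Suc k) + w k) s + inner (b (Suc k) - w k) q
      - (\<epsilon> (Suc k) + \<mu> (Suc k))" for k
  have "h \<longlonglongrightarrow> - (0 + inner (0::'a) (0::'a) + 0 + inner (0::'a) (0::'a)) + inner 0 \<alpha> + inner 0 \<beta> + inner 0 s
      + inner 0 q - (0 + 0)"
    unfolding h_def
    by (intro tendsto_diff tendsto_add tendsto_minus \<epsilon>_tendsto \<mu>_tendsto
        tendsto_zero_inner_bounded[OF z_bd ab_gap_vanishes]
        tendsto_zero_inner_bounded[OF w_bd xy_gap_vanishes]
        tendsto_inner[OF y_near_z ab_gap_vanishes] tendsto_inner[OF b_near_w xy_gap_vanishes]
        tendsto_inner[OF y_near_z tendsto_const] tendsto_inner[OF x_near_z tendsto_const]
        tendsto_inner[OF aw tendsto_const] tendsto_inner[OF b_near_w tendsto_const])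
  then have "h \<longlonglongrightarrow> 0" by simp
  from order_tendstoD(1)[OF this, of "- e"] assms(2)
  have "\<forall>\<^sub>F k in sequentially. - e < h k" by simp
  then show ?thesis
  proof (rule eventually_mono)
    fix k assume "- e < h k"
    have "- \<epsilon> (Suc k) \<le> inner (y (Suc k) - s) (a (Suc k) - \<alpha>)"
      and "- \<mu> (Suc k) \<le> inner (x (Suc k) - q) (b (Suc k) - \<beta>)"
      using a_in[of k] b_in[of k] \<alpha> \<beta> unfolding enlargement_def by auto
    moreover have "inner (z k, w k) g - r = h k + (\<epsilon> (Suc k) + \<mu> (Suc k))
        + inner (y (Suc k) - s) (a (Suc k) - \<alpha>) + inner (x (Suc k) - q) (b (Suc k) - \<beta>)"
      unfolding g r h_def by (simp add: inner_diff inner_add inner_commute algebra_simps)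
    ultimately show "r - e \<le> inner (z k, w k) g" using \<open>- e < h k\<close> by argo
  qed
qed

lemma weak_convergence:
  "\<exists>p \<in> extended_solution_set A B.
     weakly_converges (\<lambda>k. (x k, b k)) p \<and>
     weakly_converges (\<lambda>k. (y k, - a k)) p \<and>
     weakly_converges (\<lambda>k. (z k, w k)) p"
proof -
  note S = extended_solution_set_halfspaces[OF A_max B_max]
  obtain p where p: "p \<in> extended_solution_set A B" and zw: "weakly_converges (\<lambda>k. (z k, w k)) p"
    using fejer_weak_convergence[of "solution_halfspaces A B" "\<lambda>k. (z k, w k)"]
      solvable fejer iterates_near_halfspaces unfolding S by blast
  have shift: "weakly_converges Y p" if "(\<lambda>k. Y (Suc k) - (z k, w k)) \<longlonglongrightarrow> 0" for Y
    using weakly_converges_perturb[OF zw that]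
    unfolding weakly_converges_def by (simp add: filterlim_sequentially_Suc[of "\<lambda>k. inner (Y k) _"])
  have "weakly_converges (\<lambda>k. (x k, b k)) p"
    by (rule shift) (use tendsto_Pair[OF x_near_z b_near_w] in \<open>simp add: zero_prod_def\<close>)
  moreover have "weakly_converges (\<lambda>k. (y k, - a k)) p"
    by (rule shift)
      (use tendsto_Pair[OF y_near_z tendsto_minus[OF aw]] in \<open>simp add: zero_prod_def\<close>)
  ultimately show ?thesis using p zw by blast
qed

end

section \<open>Reduction to unit step size\<close>

definition scale_operator :: "real \<Rightarrow> ('a::real_vector \<Rightarrow> 'a set) \<Rightarrow> 'a \<Rightarrow> 'a set" where
  "scale_operator lam T z = (*\<^sub>R) lam ` T z"

lemma enlargement_scale:
  assumes "lam > 0"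
  shows "enlargement (scale_operator lam T) (lam * \<epsilon>) z = scale_operator lam (enlargement T \<epsilon>) z"
proof -
  have le: "- (lam * \<epsilon>) \<le> inner p (lam *\<^sub>R v - lam *\<^sub>R v') \<longleftrightarrow> - \<epsilon> \<le> inner p (v - v')"
    for p v v' :: 'a
  proof -
    have "inner p (lam *\<^sub>R v - lam *\<^sub>R v') = lam * inner p (v - v')"
      by (simp add: scaleR_diff_right[symmetric])
    moreover have "- (lam * \<epsilon>) = lam * (- \<epsilon>)" by simp
    ultimately show ?thesis using assms by (metis mult_le_cancel_left_pos)
  qed
  have mem: "lam *\<^sub>R v \<in> enlargement (scale_operator lam T) (lam * \<epsilon>) z \<longleftrightarrow> v \<in> enlargement T \<epsilon> z" for v
    unfolding enlargement_def scale_operator_def using le by simp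
  show ?thesis
  proof (intro set_eqI)
    fix u :: 'a
    define v where "v = inverse lam *\<^sub>R u"
    have u: "u = lam *\<^sub>R v" using assms by (simp add: v_def)
    have "lam *\<^sub>R v \<in> scale_operator lam (enlargement T \<epsilon>) z \<longleftrightarrow> v \<in> enlargement T \<epsilon> z"
      using assms by (auto simp: scale_operator_def)
    with mem show "u \<in> enlargement (scale_operator lam T) (lam * \<epsilon>) z
        \<longleftrightarrow> u \<in> scale_operator lam (enlargement T \<epsilon>) z"
      unfolding u by blast
  qed
qed

lemma maximal_monotone_scale:
  assumes "lam > 0" and "maximal_monotone T"
  shows "maximal_monotone (scale_operator lam T)"
  using assms enlargement_scale[OF assms(1), of T 0]
  by (simp add: maximal_monotone_iff_enlargement_0 scale_operator_def)

lemma extended_solution_set_scale: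
  assumes "lam > 0"
  shows "(s, lam *\<^sub>R v) \<in> extended_solution_set (scale_operator lam A) (scale_operator lam B)
    \<longleftrightarrow> (s, v) \<in> extended_solution_set A B"
proof -
  have "lam *\<^sub>R v \<in> scale_operator lam T s \<longleftrightarrow> v \<in> T s" for v :: 'a and T
    unfolding scale_operator_def using assms by auto
  from this[of v B] this[of "- v" A] show ?thesis by (simp add: extended_solution_set_def)
qed

text \<open>The quantities \<open>\<delta>\<close>, \<open>\<rho>\<close> and hence \<open>t\<close> contain \<open>a\<close>, \<open>b\<close> and \<open>w\<close> only multiplied by
  \<open>lam\<close>, and \<open>\<epsilon>\<close>, \<open>\<mu>\<close> likewise, so they do not change.\<close>
lemma inexact_DR_scale:
  assumes "lam > 0" and run: "inexact_DR A B lam \<sigma> \<nu> z w a y b x \<epsilon> \<mu>"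
  shows "inexact_DR (scale_operator lam A) (scale_operator lam B) 1 \<sigma> \<nu> z (\<lambda>k. lam *\<^sub>R w k)
    (\<lambda>k. lam *\<^sub>R a k) y (\<lambda>k. lam *\<^sub>R b k) x (\<lambda>k. lam * \<epsilon> k) (\<lambda>k. lam * \<mu> k)"
proof -
  have \<delta>: "DR_delta 1 z (lam *\<^sub>R w) (lam *\<^sub>R a) y (lam *\<^sub>R b) x (lam * \<epsilon>) (lam * \<mu>)
      = DR_delta lam z w a y b x \<epsilon> \<mu>" for z w a y b x :: 'a and \<epsilon> \<mu>
    by (simp add: DR_delta_def algebra_simps)
  have \<rho>: "DR_rho 1 (lam *\<^sub>R a) y (lam *\<^sub>R b) x = DR_rho lam a y b x" for a y b x :: 'a
    by (simp add: DR_rho_def algebra_simps)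
  have zero: "lam *\<^sub>R a + lam *\<^sub>R b = 0 \<longleftrightarrow> a + b = 0" for a b :: 'a
    using assms(1) by (simp add: scaleR_add_right[symmetric] del: scaleR_add_right)
  have t: "DR_t 1 \<sigma> \<nu> z (lam *\<^sub>R w) (lam *\<^sub>R a) y (lam *\<^sub>R b) x (lam * \<epsilon>) (lam * \<mu>)
      = DR_t lam \<sigma> \<nu> z w a y b x \<epsilon> \<mu>" for z w a y b x :: 'a and \<epsilon> \<mu>
    unfolding DR_t_def \<delta> \<rho> zero by (simp add: scaleR_add_right)
  show ?thesis
    unfolding inexact_DR_def
  proof (intro allI impI)
    fix k :: nat assume "1 \<le> k"
    define t where "t = DR_t lam \<sigma> \<nu> (z (k - 1)) (w (k - 1)) (a k) (y k) (b k) (x k) (\<epsilon> k) (\<mu> k)"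
    have k: "0 \<le> \<epsilon> k" "0 \<le> \<mu> k" "a k \<in> enlargement A (\<epsilon> k) (y k)" "b k \<in> enlargement B (\<mu> k) (x k)"
      "DR_delta lam (z (k - 1)) (w (k - 1)) (a k) (y k) (b k) (x k) (\<epsilon> k) (\<mu> k)
        \<le> \<sigma>\<^sup>2 / 4 * DR_rho lam (a k) (y k) (b k) (x k)"
      "z k = z (k - 1) - ((1 - t) * lam) *\<^sub>R (a k + b k)"
      "w k = w (k - 1) - ((1 - t) * inverse lam) *\<^sub>R (x k - y k)"
      using run \<open>1 \<le> k\<close> unfolding inexact_DR_def t_def Let_def by blast+
    have "lam *\<^sub>R a k \<in> enlargement (scale_operator lam A) (lam * \<epsilon> k) (y k)"
      "lam *\<^sub>R b k \<in> enlargement (scale_operator lam B) (lam * \<mu> k) (x k)"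
      using k(3,4) unfolding enlargement_scale[OF assms(1)] scale_operator_def by blast+
    moreover have "z k = z (k - 1) - ((1 - t) * 1) *\<^sub>R (lam *\<^sub>R a k + lam *\<^sub>R b k)"
      using k(6) by (simp add: scaleR_add_right)
    moreover have "lam *\<^sub>R w k = lam *\<^sub>R w (k - 1) - ((1 - t) * inverse 1) *\<^sub>R (x k - y k)"
    proof -
      have "lam * ((1 - t) * inverse lam) = 1 - t" using assms(1) by simp
      then show ?thesis
        by (subst k(7)) (simp only: scaleR_right_diff_distrib scaleR_scaleR inverse_1 mult_1_right)
    qed
    ultimately show "0 \<le> lam * \<epsilon> k \<and> 0 \<le> lam * \<mu> k \<and>
        lam *\<^sub>R a k \<in> enlargement (scale_operator lam A) (lam * \<epsilon> k) (y k) \<and>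
        lam *\<^sub>R b k \<in> enlargement (scale_operator lam B) (lam * \<mu> k) (x k) \<and>
        DR_delta 1 (z (k - 1)) (lam *\<^sub>R w (k - 1)) (lam *\<^sub>R a k) (y k) (lam *\<^sub>R b k) (x k)
            (lam * \<epsilon> k) (lam * \<mu> k)
          \<le> \<sigma>\<^sup>2 / 4 * DR_rho 1 (lam *\<^sub>R a k) (y k) (lam *\<^sub>R b k) (x k) \<and>
        (let t = DR_t 1 \<sigma> \<nu> (z (k - 1)) (lam *\<^sub>R w (k - 1)) (lam *\<^sub>R a k) (y k) (lam *\<^sub>R b k) (x k)
            (lam * \<epsilon> k) (lam * \<mu> k)
         in z k = z (k - 1) - ((1 - t) * 1) *\<^sub>R (lam *\<^sub>R a k + lam *\<^sub>R b k) \<and>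
            lam *\<^sub>R w k = lam *\<^sub>R w (k - 1) - ((1 - t) * inverse 1) *\<^sub>R (x k - y k))"
      unfolding \<delta> \<rho> t t_def[symmetric] Let_def using k(1,2,5) assms(1) by simp
  qed
qed

lemma weakly_converges_unscale_snd:
  assumes "lam \<noteq> 0" and "weakly_converges (\<lambda>k. (X k, lam *\<^sub>R Y k)) (s, lam *\<^sub>R v)"
  shows "weakly_converges (\<lambda>k. (X k, Y k)) (s, v)"
  unfolding weakly_converges_def
proof
  fix u :: "'a \<times> 'b"
  obtain p q where u: "u = (p, q)" by (cases u)
  have "(\<lambda>k. inner (X k, lam *\<^sub>R Y k) (p, inverse lam *\<^sub>R q))
      \<longlonglongrightarrow> inner (s, lam *\<^sub>R v) (p, inverse lam *\<^sub>R q)"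
    using assms(2) unfolding weakly_converges_def by blast
  then show "(\<lambda>k. inner (X k, Y k) u) \<longlonglongrightarrow> inner (s, v) u"
    using assms(1) by (simp add: u mult.assoc[symmetric])
qed

theorem theorem3p3:
  fixes A B :: "'a::{real_inner, complete_space} \<Rightarrow> 'a set"
    and lam \<sigma> \<nu> :: real
    and z w a y b x :: "nat \<Rightarrow> 'a"
    and \<epsilon> \<mu> :: "nat \<Rightarrow> real"
  assumes "maximal_monotone A" and "maximal_monotone B"
    and "lam > 0" and "0 < \<sigma>" and "\<sigma> < \<nu>" and "\<nu> < 1"
    and "inexact_DR A B lam \<sigma> \<nu> z w a y b x \<epsilon> \<mu>"
    and "extended_solution_set A B \<noteq> {}"
  shows "\<exists>p \<in> extended_solution_set A B.
           weakly_converges (\<lambda>k. (x k, b k)) p \<and>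
           weakly_converges (\<lambda>k. (y k, - a k)) p \<and>
           weakly_converges (\<lambda>k. (z k, w k)) p"
proof -
  obtain c d where "(c, d) \<in> extended_solution_set A B" using assms(8) by auto
  then have "(c, lam *\<^sub>R d) \<in> extended_solution_set (scale_operator lam A) (scale_operator lam B)"
    using extended_solution_set_scale[OF assms(3)] by blast
  then interpret unit: unit_step_DR "scale_operator lam A" "scale_operator lam B" \<sigma> \<nu> z
    "\<lambda>k. lam *\<^sub>R w k" "\<lambda>k. lam *\<^sub>R a k" y "\<lambda>k. lam *\<^sub>R b k" x "\<lambda>k. lam * \<epsilon> k" "\<lambda>k. lam * \<mu> k"
    using assms by unfold_locales (auto intro: maximal_monotone_scale inexact_DR_scale)
  obtain p where p: "p \<in> extended_solution_set (scale_operator lam A) (scale_operator lam B)"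
    and conv: "weakly_converges (\<lambda>k. (x k, lam *\<^sub>R b k)) p"
      "weakly_converges (\<lambda>k. (y k, - (lam *\<^sub>R a k))) p"
      "weakly_converges (\<lambda>k. (z k, lam *\<^sub>R w k)) p"
    using unit.weak_convergence by blast
  define s where "s = fst p"
  define v where "v = inverse lam *\<^sub>R snd p"
  have p_eq: "p = (s, lam *\<^sub>R v)" using assms(3) by (simp add: s_def v_def)
  have unscale: "weakly_converges (\<lambda>k. (X k, Y k)) (s, v)"
    if "weakly_converges (\<lambda>k. (X k, lam *\<^sub>R Y k)) p" for X Y :: "nat \<Rightarrow> 'a"
    using weakly_converges_unscale_snd[of lam X Y s v] that assms(3) by (simp add: p_eq)
  have "(s, v) \<in> extended_solution_set A B"
    using p unfolding p_eq by (rule extended_solution_set_scale[OF assms(3), THEN iffD1])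
  moreover have "weakly_converges (\<lambda>k. (x k, b k)) (s, v)" "weakly_converges (\<lambda>k. (z k, w k)) (s, v)"
    using conv by (auto intro: unscale)
  moreover have "weakly_converges (\<lambda>k. (y k, - a k)) (s, v)"
    using conv(2) by (intro unscale) simp
  ultimately show ?thesis by blast
qed

end
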